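(* Let $\alpha,\beta>0$ and let $\mathcal{D}=(\mathcal{D}_{m,n})_{m,n\in\mathbb{Z}_+}$, $\mathcal{D}_{m,n}=\int_{-1}^1\varphi_m'(x)\varphi_n(x)\,dx$, be the differentiation matrix of the Jacobi W-functions $\varphi_n(x)=(1-x)^{\alpha/2}(1+x)^{\beta/2}p_n(x)$, $x\in(-1,1)$. Then $\mathcal{D}$ is semi-separable of rank $2$, with $$\mathcal{D}_{m,n}=\begin{cases}\sum_{i=1}^2 a_m^{[i]}b_n^{[i]}, & m\leq n-1,\\ 0,& m=n,\\ -\sum_{i=1}^2 b_m^{[i]}a_n^{[i]},& m\geq n+1,\end{cases}$$ where, for $m,n\in\mathbb{Z}_+$, $$a_m^{[1]}=\frac{(-1)^{m-1}}{2\,m!}\sqrt{\frac{(2m+\alpha+\beta+1)\Gamma(m+\beta+1)\Gamma(m+\alpha+\beta+1)}{\Gamma(m+\alpha+1)}},$$ $$b_n^{[1]}=\frac{(-1)^n}{2}\sqrt{\frac{(2n+\alpha+\beta+1)\Gamma(n+\alpha+1)}{\Gamma(n+\beta+1)\Gamma(n+\alpha+\beta+1)}},$$ $$a_m^{[2]}=\frac{1}{2\,m!}\sqrt{\frac{(2m+\alpha+\beta+1)\Gamma(m+\alpha+1)\Gamma(m+\alpha+\beta+1)}{\Gamma(m+\beta+1)}},$$ $$b_n^{[2]}=\frac12\sqrt{\frac{(2n+\alpha+\beta+1)\Gamma(n+\beta+1)}{\Gamma(n+\alpha+1)\Gamma(n+\alpha+\beta+1)}}.$$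
   Context: $\mathbb{Z}_+=\{0,1,2,\ldots\}$. $P_n^{(\alpha,\beta)}$ denotes the Jacobi polynomial of degree $n$ in its standard normalization; these polynomials are orthogonal on $(-1,1)$ with respect to the weight $w_{\alpha,\beta}(x)=(1-x)^\alpha(1+x)^\beta$. The orthonormal Jacobi polynomials are $p_n=\kappa_nP_n^{(\alpha,\beta)}$, where $\kappa_n>0$ is determined by $\int_{-1}^1 w_{\alpha,\beta}(x)P_m^{(\alpha,\beta)}(x)P_n^{(\alpha,\beta)}(x)\,dx=\delta_{m,n}\kappa_n^{-2}$. A (finite or infinite) matrix is semi-separable of rank $r\geq1$ if every submatrix lying wholly above or wholly below the main diagonal has rank $\leq r$.
   Formalization: The printed constants are wrong (for α=β=2 they give D_{0,1}=+√7/2; the true value is −√7/2). Corrected: a^{[1]} and a^{[2]} change sign, their factor 1/m! is moved under the square root, and a factor n! is added under the square root in b^{[1]} and b^{[2]}. *)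

theory Defs
  imports "HOL-Analysis.Analysis" "HOL-Library.Function_Algebras"
begin

section \<open>Jacobi polynomials and Jacobi W-functions\<close>

text \<open>Standard normalization, i.e. the value at \<open>1\<close> is \<open>(n + \<alpha>) gchoose n\<close>.\<close>

definition jacobi_poly :: "real \<Rightarrow> real \<Rightarrow> nat \<Rightarrow> real \<Rightarrow> real" where
  "jacobi_poly \<alpha> \<beta> n x =
     (\<Sum>k\<le>n. ((real n + \<alpha>) gchoose (n - k)) * ((real n + \<beta>) gchoose k)
            * ((x - 1) / 2) ^ k * ((x + 1) / 2) ^ (n - k))"

definition jacobi_weight :: "real \<Rightarrow> real \<Rightarrow> real \<Rightarrow> real" where
  "jacobi_weight \<alpha> \<beta> x = (1 - x) powr \<alpha> * (1 + x) powr \<beta>"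

text \<open>The positive number whose inverse square is the squared weighted norm of
  \<open>jacobi_poly \<alpha> \<beta> n\<close>.\<close>

definition jacobi_kappa :: "real \<Rightarrow> real \<Rightarrow> nat \<Rightarrow> real" where
  "jacobi_kappa \<alpha> \<beta> n =
     1 / sqrt (LBINT x:{-1<..<1}. jacobi_weight \<alpha> \<beta> x * jacobi_poly \<alpha> \<beta> n x * jacobi_poly \<alpha> \<beta> n x)"

definition jacobi_orthonormal :: "real \<Rightarrow> real \<Rightarrow> nat \<Rightarrow> real \<Rightarrow> real" where
  "jacobi_orthonormal \<alpha> \<beta> n x = jacobi_kappa \<alpha> \<beta> n * jacobi_poly \<alpha> \<beta> n x"

definition jacobi_W :: "real \<Rightarrow> real \<Rightarrow> nat \<Rightarrow> real \<Rightarrow> real" where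
  "jacobi_W \<alpha> \<beta> n x =
     (1 - x) powr (\<alpha> / 2) * (1 + x) powr (\<beta> / 2) * jacobi_orthonormal \<alpha> \<beta> n x"

definition jacobi_diff_matrix :: "real \<Rightarrow> real \<Rightarrow> nat \<Rightarrow> nat \<Rightarrow> real" where
  "jacobi_diff_matrix \<alpha> \<beta> m n =
     (LBINT x:{-1<..<1}. deriv (jacobi_W \<alpha> \<beta> m) x * jacobi_W \<alpha> \<beta> n x)"


section \<open>Semi-separability\<close>

text \<open>The rank of the submatrix with rows \<open>I\<close> and columns \<open>J\<close> is the dimension of the span of
  its rows. Each row is extended by zero outside \<open>J\<close>, so that all of them live in the vector space
  of sequences. The sets \<open>I\<close> and \<open>J\<close> may be infinite. The function \<open>dim\<close> of the library is \<open>0\<close>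
  on infinite-dimensional spaces; this does no harm to the notion below, because a submatrix above
  (below) the diagonal has only finitely many rows (columns) that are not empty.\<close>

definition seq_scale :: "real \<Rightarrow> (nat \<Rightarrow> real) \<Rightarrow> (nat \<Rightarrow> real)" where
  "seq_scale c f = (\<lambda>j. c * f j)"

lemma vector_space_seq_scale: "vector_space seq_scale"
  by unfold_locales (auto simp: seq_scale_def fun_eq_iff algebra_simps)

definition submatrix_rank :: "(nat \<Rightarrow> nat \<Rightarrow> real) \<Rightarrow> nat set \<Rightarrow> nat set \<Rightarrow> nat" where
  "submatrix_rank A I J =
     vector_space.dim seq_scale ((\<lambda>i j. if j \<in> J then A i j else 0) ` I)"

definition semi_separable :: "nat \<Rightarrow> (nat \<Rightarrow> nat \<Rightarrow> real) \<Rightarrow> bool" where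
  "semi_separable r A \<longleftrightarrow> 1 \<le> r \<and>
     (\<forall>I J. ((\<forall>i\<in>I. \<forall>j\<in>J. i < j) \<or> (\<forall>i\<in>I. \<forall>j\<in>J. j < i)) \<longrightarrow> submatrix_rank A I J \<le> r)"


section \<open>The generators\<close>

text \<open>The constants are those forced by the definition of \<open>jacobi_diff_matrix\<close>. They differ
  from the printed ones, which have \<open>1 / m!\<close> outside the root in \<open>a\<close>, no factorial in \<open>b\<close>, and
  the opposite sign of \<open>a\<close>. The printed constants are incorrect: for \<open>\<alpha> = \<beta> = 2\<close> they
  give the entry \<open>(0, 1)\<close> as \<open>sqrt 7 / 2\<close>, whereas
  \<open>\<phi>\<^sub>0 = sqrt (15/16) (1 - x\<^sup>2)\<close> and \<open>\<phi>\<^sub>1 = sqrt (105/16) x (1 - x\<^sup>2)\<close> give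
  \<open>- sqrt 7 / 2\<close>.\<close>

definition gen_a1 :: "real \<Rightarrow> real \<Rightarrow> nat \<Rightarrow> real" where
  "gen_a1 \<alpha> \<beta> m = (-1) ^ m / 2 *
     sqrt ((2 * real m + \<alpha> + \<beta> + 1) * Gamma (real m + \<beta> + 1) * Gamma (real m + \<alpha> + \<beta> + 1)
           / (fact m * Gamma (real m + \<alpha> + 1)))"

definition gen_b1 :: "real \<Rightarrow> real \<Rightarrow> nat \<Rightarrow> real" where
  "gen_b1 \<alpha> \<beta> n = (-1) ^ n / 2 *
     sqrt (fact n * (2 * real n + \<alpha> + \<beta> + 1) * Gamma (real n + \<alpha> + 1)
           / (Gamma (real n + \<beta> + 1) * Gamma (real n + \<alpha> + \<beta> + 1)))"

definition gen_a2 :: "real \<Rightarrow> real \<Rightarrow> nat \<Rightarrow> real" where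
  "gen_a2 \<alpha> \<beta> m = - 1 / 2 *
     sqrt ((2 * real m + \<alpha> + \<beta> + 1) * Gamma (real m + \<alpha> + 1) * Gamma (real m + \<alpha> + \<beta> + 1)
           / (fact m * Gamma (real m + \<beta> + 1)))"

definition gen_b2 :: "real \<Rightarrow> real \<Rightarrow> nat \<Rightarrow> real" where
  "gen_b2 \<alpha> \<beta> n = 1 / 2 *
     sqrt (fact n * (2 * real n + \<alpha> + \<beta> + 1) * Gamma (real n + \<beta> + 1)
           / (Gamma (real n + \<alpha> + 1) * Gamma (real n + \<alpha> + \<beta> + 1)))"

end

theory Submission
  imports Defs
begin

text \<open>The entry at \<open>(m, n)\<close> is \<open>\<kappa>\<^sub>m \<kappa>\<^sub>n\<close> times the integral of
  \<open>w\<^bsub>\<alpha>,\<beta>\<^esub> P\<^sub>n (P\<^sub>m' + (\<beta> / (1 + x) - \<alpha> / (1 - x)) P\<^sub>m / 2)\<close>. For \<open>m < n\<close> orthogonality kills the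
  first summand and allows replacing \<open>P\<^sub>m\<close> by its value at the endpoint in the other two. What
  remains are the integrals of \<open>P\<^sub>n\<close> against \<open>w\<^bsub>\<alpha>-1,\<beta>\<^esub>\<close> and \<open>w\<^bsub>\<alpha>,\<beta>-1\<^esub>\<close>, so the
  entry is a sum of two products. These integrals, and the norms, follow by
  integrating by parts with the one-step Rodrigues formula
  \<open>(w\<^bsub>\<alpha>+1,\<beta>+1\<^esub> P\<^sub>n\<^bsup>(\<alpha>+1,\<beta>+1)\<^esup>)' = - 2 (n + 1) w\<^bsub>\<alpha>,\<beta>\<^esub> P\<^bsub>n+1\<^esub>\<^bsup>(\<alpha>,\<beta>)\<^esup>\<close>. Since
  \<open>\<phi>\<^sub>m \<phi>\<^sub>n\<close> vanishes at \<open>\<plusminus>1\<close>, the matrix is antisymmetric, which gives the other entries.\<close>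

section \<open>Integrals of polynomials against Jacobi weights\<close>

text \<open>Prepares the substitution \<open>t = (1 + x) / 2\<close>, which turns the weight into
  the integrand of the Beta function on the unit interval.\<close>

lemma jacobi_weight_affine:
  assumes "x \<in> {-1<..<1}"
  shows "jacobi_weight a b x = 2 powr (a + b) * (((1 + x) / 2) powr b * (1 - (1 + x) / 2) powr a)"
proof -
  have "1 - (1 + x) / 2 = (1 - x) / 2" by (simp add: field_simps)
  show ?thesis
    unfolding \<open>1 - (1 + x) / 2 = (1 - x) / 2\<close>
    using assms by (simp add: jacobi_weight_def powr_divide powr_add)
qed

lemma
  assumes "a > -1" "b > -1"
  shows set_integrable_jacobi_weight: "set_integrable lborel {-1<..<1} (jacobi_weight a b)"
    and integral_jacobi_weight:
      "(LBINT x:{-1<..<1}. jacobi_weight a b x) = 2 powr (a + b + 1) * Beta (a + 1) (b + 1)"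
proof -
  define h where "h = (\<lambda>t::real. indicator {0..1} t *\<^sub>R (t powr b * (1 - t) powr a))"
  have h: "indicator {-1<..<1} x *\<^sub>R jacobi_weight a b x = 2 powr (a + b) * h (1 / 2 + 1 / 2 * x)" for x
  proof (cases "x \<in> {-1<..<1}")
    case True
    have "1 / 2 + 1 / 2 * x = (1 + x) / 2" by simp
    then show ?thesis
      unfolding \<open>1 / 2 + 1 / 2 * x = (1 + x) / 2\<close> using True jacobi_weight_affine[OF True, of a b]
      by (simp add: h_def)
  next
    \<comment> \<open>At \<open>x = 1\<close> and \<open>x = -1\<close> the closed indicator in
      \<open>h\<close> is 1, but \<open>0 powr c = 0\<close> for every exponent \<open>c\<close>, so
      both sides still vanish.\<close>
    case False
    then show ?thesis by (auto simp: h_def indicator_def)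
  qed
  have int: "set_integrable lborel {0..1} (\<lambda>t. t powr (b + 1 - 1) * (1 - t) powr (a + 1 - 1))"
    using assms by (intro integrable_Beta) auto
  then have int_h: "integrable lborel h"
    by (simp add: set_integrable_def h_def)
  then show "set_integrable lborel {-1<..<1} (jacobi_weight a b)"
    unfolding set_integrable_def h by (intro integrable_mult_right lborel_integrable_real_affine) auto
  have "((\<lambda>t. t powr (b + 1 - 1) * (1 - t) powr (a + 1 - 1)) has_integral Beta (b + 1) (a + 1)) {0..1}"
    using assms by (intro has_integral_Beta_real) auto
  then have "integral\<^sup>L lborel h = Beta (b + 1) (a + 1)"
    using set_borel_integral_eq_integral(2)[OF int]
    by (simp add: h_def set_lebesgue_integral_def integral_unique)
  moreover have "integral\<^sup>L lborel h = (1 / 2) * (\<integral>x. h (1 / 2 + 1 / 2 * x) \<partial>lborel)"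
    using lborel_integral_real_affine[of "1 / 2" h "1 / 2"] by simp
  ultimately show "(LBINT x:{-1<..<1}. jacobi_weight a b x) = 2 powr (a + b + 1) * Beta (a + 1) (b + 1)"
    unfolding set_lebesgue_integral_def h by (simp add: Beta_commute powr_add)
qed

text \<open>The argument is a formal polynomial, so that integrands can be rewritten by ring
  identities and degrees and coefficients are at hand.\<close>

definition jacobi_integral :: "real \<Rightarrow> real \<Rightarrow> real poly \<Rightarrow> real" where
  "jacobi_integral a b p = (LBINT x:{-1<..<1}. jacobi_weight a b x * poly p x)"

lemma jacobi_weight_measurable [measurable]: "jacobi_weight a b \<in> borel_measurable borel"
  unfolding jacobi_weight_def by measurable

text \<open>A polynomial is bounded on the compact interval \<open>{-1..1}\<close>, so a multiple of
  the weight dominates the integrand.\<close>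

lemma set_integrable_jacobi_weight_poly:
  assumes "a > -1" "b > -1"
  shows "set_integrable lborel {-1<..<1} (\<lambda>x. jacobi_weight a b x * poly p x)"
proof -
  have "compact (poly p ` {-1..1})"
    by (intro compact_continuous_image continuous_intros) auto
  then obtain B where B: "\<forall>x\<in>{-1..1}. \<bar>poly p x\<bar> \<le> B"
    by (auto dest!: compact_imp_bounded simp: bounded_iff)
  have [measurable]: "poly p \<in> borel_measurable borel"
    by (intro borel_measurable_continuous_onI continuous_intros)
  have *: "set_integrable lborel {-1<..<1} (\<lambda>x. B * jacobi_weight a b x)"
    using assms by (intro set_integrable_mult_right set_integrable_jacobi_weight)
  show ?thesis
    unfolding set_integrable_def
  proof (rule Bochner_Integration.integrable_bound[OF *[unfolded set_integrable_def]])
    show "AE x in lborel. norm (indicator {-1<..<1} x *\<^sub>R (jacobi_weight a b x * poly p x))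
            \<le> norm (indicator {-1<..<1} x *\<^sub>R (B * jacobi_weight a b x))"
    proof (intro AE_I2)
      fix x :: real
      have "x \<in> {-1<..<1} \<Longrightarrow> \<bar>poly p x\<bar> * \<bar>jacobi_weight a b x\<bar> \<le> \<bar>B\<bar> * \<bar>jacobi_weight a b x\<bar>"
        by (intro mult_right_mono order_trans[OF bspec[OF B] abs_ge_self]) auto
      then show "norm (indicator {-1<..<1} x *\<^sub>R (jacobi_weight a b x * poly p x))
            \<le> norm (indicator {-1<..<1} x *\<^sub>R (B * jacobi_weight a b x))"
        by (auto simp: indicator_def abs_mult mult.commute)
    qed
  qed measurable
qed

lemma jacobi_integral_add:
  assumes "a > -1" "b > -1"
  shows "jacobi_integral a b (p + q) = jacobi_integral a b p + jacobi_integral a b q"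
  unfolding jacobi_integral_def using set_integrable_jacobi_weight_poly[OF assms]
  by (simp add: distrib_left set_integral_add)

lemma jacobi_integral_smult: "jacobi_integral a b (smult c p) = c * jacobi_integral a b p"
  unfolding jacobi_integral_def
  by (simp add: mult.left_commute[of _ c] flip: set_integral_mult_right)

lemma jacobi_integral_mult_right_endpoint:
  "jacobi_integral a b ([:1, -1:] * p) = jacobi_integral (a + 1) b p"
  unfolding jacobi_integral_def
  by (intro set_lebesgue_integral_cong)
    (auto simp: jacobi_weight_def powr_add algebra_simps)

lemma jacobi_integral_mult_left_endpoint:
  "jacobi_integral a b ([:1, 1:] * p) = jacobi_integral a (b + 1) p"
  unfolding jacobi_integral_def
  by (intro set_lebesgue_integral_cong)
    (auto simp: jacobi_weight_def powr_add algebra_simps)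

text \<open>\<open>pearson a b q\<close> is the polynomial \<open>p\<close> with
  \<open>(w\<^bsub>a+1,b+1\<^esub> q)' = w\<^bsub>a,b\<^esub> p\<close>.\<close>

definition pearson :: "real \<Rightarrow> real \<Rightarrow> real poly \<Rightarrow> real poly" where
  "pearson a b q = [:1, 0, -1:] * pderiv q + [:b - a, - (a + b + 2):] * q"

lemma jacobi_weight_poly_has_derivative:
  assumes "x \<in> {-1<..<1}"
  shows "((\<lambda>x. jacobi_weight (a + 1) (b + 1) x * poly q x) has_real_derivative
          jacobi_weight a b x * poly (pearson a b q) x) (at x)"
proof -
  have "(jacobi_weight (a + 1) (b + 1) has_real_derivative
      (1 - x) powr (a + 1) * ((b + 1) * (1 + x) powr b) - (a + 1) * (1 - x) powr a * (1 + x) powr (b + 1)) (at x)"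
    unfolding jacobi_weight_def using assms
    by (auto intro!: derivative_eq_intros simp: algebra_simps)
  from DERIV_mult[OF this poly_DERIV[of q x]] show ?thesis
    by (rule DERIV_cong)
      (use assms in \<open>simp add: jacobi_weight_def pearson_def powr_add algebra_simps power2_eq_square\<close>)
qed

text \<open>The integrand is the derivative of \<open>F\<close>. Since \<open>a + 1\<close> and
  \<open>b + 1\<close> are positive, \<open>F\<close> is continuous up to the endpoints and zero
  there. The derivative may blow up at the endpoints, hence the version of the fundamental theorem
  that asks for it only in the interior.\<close>

lemma jacobi_integral_pearson:
  assumes "a > -1" "b > -1"
  shows "jacobi_integral a b (pearson a b q) = 0"
proof -
  define F where "F = (\<lambda>x. jacobi_weight (a + 1) (b + 1) x * poly q x)"
  have cont: "continuous_on {-1..1} F"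
    unfolding F_def jacobi_weight_def using assms
    by (intro continuous_intros continuous_on_powr') auto
  have "((\<lambda>x. jacobi_weight a b x * poly (pearson a b q) x) has_integral F 1 - F (-1)) {-1..1}"
    using cont
  proof (rule fundamental_theorem_of_calculus_interior[rotated])
    fix x :: real assume "x \<in> {-1<..<1}"
    from jacobi_weight_poly_has_derivative[OF this]
    show "(F has_vector_derivative jacobi_weight a b x * poly (pearson a b q) x) (at x)"
      unfolding F_def has_real_derivative_iff_has_vector_derivative .
  qed simp
  then have "((\<lambda>x. jacobi_weight a b x * poly (pearson a b q) x) has_integral 0) {-1<..<1}"
    by (simp add: F_def jacobi_weight_def has_integral_Icc_iff_Ioo)
  then show ?thesis
    unfolding jacobi_integral_def
    using set_borel_integral_eq_integral(2)[OF set_integrable_jacobi_weight_poly[OF assms]]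
    by (simp add: integral_unique)
qed

lemma jacobi_integral_mult_both_endpoints:
  "jacobi_integral a b ([:1, 0, -1:] * p) = jacobi_integral (a + 1) (b + 1) p"
proof -
  have "[:1, 0, -1:] * p = [:1, -1:] * ([:1, 1:] * p)"
    by (simp flip: mult.assoc)
  then show ?thesis
    by (simp only: jacobi_integral_mult_right_endpoint jacobi_integral_mult_left_endpoint)
qed

section \<open>Product and shift rules for \<open>pearson\<close>\<close>

lemma pearson_mult: "pearson a b (p * q) = pearson a b p * q + [:1, 0, -1:] * (p * pderiv q)"
  unfolding pearson_def pderiv_mult by (simp only: algebra_simps)

text \<open>The Leibniz rule for a product of two weighted polynomials. The exponents of the weights
  add, and \<open>(a + 1) + (c + 1) = (a + c + 1) + 1\<close>.\<close>

lemma pearson_add_mult: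
  "pearson a b p * q + p * pearson c d q = pearson (a + c + 1) (b + d + 1) (p * q)"
proof (rule poly_ext)
  fix x show "poly (pearson a b p * q + p * pearson c d q) x = poly (pearson (a + c + 1) (b + d + 1) (p * q)) x"
    unfolding pearson_def pderiv_mult by (simp add: algebra_simps)
qed

text \<open>Lets the Rodrigues formula for \<alpha> be used under a weight with exponent
  \<open>\<alpha> - s\<close>, at the price of one extra term.\<close>

lemma pearson_diff_left: "pearson (a - s) b q = pearson a b q + smult s ([:1, 1:] * q)"
  by (rule poly_ext) (simp add: pearson_def algebra_simps)

lemma pearson_diff_right: "pearson a (b - s) q = pearson a b q + smult (- s) ([:1, -1:] * q)"
  by (rule poly_ext) (simp add: pearson_def algebra_simps)

section \<open>Jacobi polynomials\<close>

definition jacobi_coeff :: "real \<Rightarrow> real \<Rightarrow> nat \<Rightarrow> nat \<Rightarrow> real" where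
  "jacobi_coeff \<alpha> \<beta> n k = ((real n + \<alpha>) gchoose (n - k)) * ((real n + \<beta>) gchoose k)"

definition Jacobi :: "real \<Rightarrow> real \<Rightarrow> nat \<Rightarrow> real poly" where
  "Jacobi \<alpha> \<beta> n = (\<Sum>k\<le>n. smult (jacobi_coeff \<alpha> \<beta> n k) ([:-1/2, 1/2:] ^ k * [:1/2, 1/2:] ^ (n - k)))"

lemma poly_Jacobi: "poly (Jacobi \<alpha> \<beta> n) x = jacobi_poly \<alpha> \<beta> n x"
proof -
  have eval: "poly [:-1/2, 1/2:] x = (x - 1) / 2" "poly [:1/2, 1/2:] x = (x + 1) / 2"
    by (simp_all add: field_simps)
  show ?thesis
    unfolding Jacobi_def jacobi_coeff_def jacobi_poly_def poly_sum poly_smult poly_mult poly_power eval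
    by (simp only: mult.assoc)
qed

lemma Jacobi_0 [simp]: "Jacobi \<alpha> \<beta> 0 = 1"
  by (simp add: Jacobi_def jacobi_coeff_def)

lemma Jacobi_at_1: "poly (Jacobi \<alpha> \<beta> n) 1 = ((real n + \<alpha>) gchoose n)"
proof -
  have "poly (Jacobi \<alpha> \<beta> n) 1 = (\<Sum>k\<le>n. if k = 0 then ((real n + \<alpha>) gchoose n) else 0)"
    unfolding poly_Jacobi jacobi_poly_def by (intro sum.cong) auto
  then show ?thesis by simp
qed

lemma Jacobi_at_minus_1: "poly (Jacobi \<alpha> \<beta> n) (-1) = (-1) ^ n * ((real n + \<beta>) gchoose n)"
proof -
  have "poly (Jacobi \<alpha> \<beta> n) (-1) = (\<Sum>k\<le>n. if k = n then (-1) ^ n * ((real n + \<beta>) gchoose n) else 0)"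
    unfolding poly_Jacobi jacobi_poly_def by (intro sum.cong) auto
  then show ?thesis by simp
qed

text \<open>Each of the \<open>n + 1\<close> products has degree \<open>n\<close> and leading
  coefficient \<open>1 / 2 ^ n\<close>, so the top coefficient is a Vandermonde convolution. It can
  vanish for special parameters, hence only a bound on the degree.\<close>

lemma
  shows degree_Jacobi_le: "degree (Jacobi \<alpha> \<beta> n) \<le> n"
    and coeff_Jacobi: "coeff (Jacobi \<alpha> \<beta> n) n = ((2 * real n + \<alpha> + \<beta>) gchoose n) / 2 ^ n"
proof -
  have deg: "degree ([:-1/2, 1/2:] ^ k * [:1/2, 1/2:] ^ (n - k) :: real poly) = n" if "k \<le> n" for k
    using that by (subst degree_mult_eq) (auto simp: degree_power_eq)
  then show "degree (Jacobi \<alpha> \<beta> n) \<le> n"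
    unfolding Jacobi_def by (intro degree_sum_le) (auto intro: degree_smult_le[THEN order_trans])
  have lead: "coeff ([:-1/2, 1/2:] ^ k * [:1/2, 1/2:] ^ (n - k) :: real poly) n = 1 / 2 ^ n" if "k \<le> n" for k
  proof -
    have "lead_coeff ([:-1/2, 1/2:] ^ k * [:1/2, 1/2:] ^ (n - k) :: real poly) = (1/2) ^ k * (1/2) ^ (n - k)"
      by (simp add: lead_coeff_mult lead_coeff_power)
    also have "\<dots> = 1 / 2 ^ n" using that by (simp add: power_divide flip: power_add)
    finally show ?thesis unfolding deg[OF that] .
  qed
  have "coeff (Jacobi \<alpha> \<beta> n) n = (\<Sum>k\<le>n. jacobi_coeff \<alpha> \<beta> n k / 2 ^ n)"
    unfolding Jacobi_def coeff_sum
    by (intro sum.cong refl) (simp only: coeff_smult lead atMost_iff times_divide_eq_right mult_1_right)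
  also have "\<dots> = (\<Sum>k=0..n. ((real n + \<beta>) gchoose k) * ((real n + \<alpha>) gchoose (n - k))) / 2 ^ n"
    by (simp add: jacobi_coeff_def sum_divide_distrib mult.commute atMost_atLeast0)
  also have "\<dots> = ((2 * real n + \<alpha> + \<beta>) gchoose n) / 2 ^ n"
    unfolding gbinomial_Vandermonde by (simp add: add_ac)
  finally show "coeff (Jacobi \<alpha> \<beta> n) n = ((2 * real n + \<alpha> + \<beta>) gchoose n) / 2 ^ n" .
qed

section \<open>The one-step Rodrigues formula\<close>

lemma gbinomial_Suc_mult: "(a - real k) * (a gchoose k) = real (Suc k) * (a gchoose Suc k)"
  by (simp only: gbinomial_absorption gbinomial_absorb_comp)

text \<open>In \<open>u = (x - 1) / 2\<close> and \<open>v = (x + 1) / 2\<close> the weight is, up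
  to constants, a product of powers of \<open>- u\<close> and \<open>v\<close>. Differentiating such
  a product lowers one exponent at a time, which leaves two neighbouring monomials.\<close>

lemma pearson_monomial:
  "pearson \<alpha> \<beta> ([:-1/2, 1/2:] ^ k * [:1/2, 1/2:] ^ m) =
     smult (- 2 * (real k + \<alpha> + 1)) ([:-1/2, 1/2:] ^ k * [:1/2, 1/2:] ^ Suc m) +
     smult (- 2 * (real m + \<beta> + 1)) ([:-1/2, 1/2:] ^ Suc k * [:1/2, 1/2:] ^ m)"
proof (rule poly_ext)
  fix x :: real
  define u v where "u = (x - 1) / 2" "v = (x + 1) / 2"
  have x: "x = u + v" "v = u + 1" by (simp_all add: u_v_def field_simps)
  have uv: "poly [:-1/2, 1/2:] x = u" "poly [:1/2, 1/2:] x = v" by (simp_all add: u_v_def field_simps)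
  \<comment> \<open>For \<open>k = 0\<close> the exponent \<open>k - 1\<close> is truncated, but the
    factor \<open>real k\<close> is then 0.\<close>
  have k: "real k * u ^ (k - 1) * u = real k * u ^ k" by (cases k) auto
  have m: "real m * v ^ (m - 1) * v = real m * v ^ m" by (cases m) auto
  have D: "poly (pderiv ([:-1/2, 1/2:] ^ k * [:1/2, 1/2:] ^ m)) x =
     (real k * u ^ (k - 1) * v ^ m + u ^ k * (real m * v ^ (m - 1))) / 2"
    unfolding pderiv_mult pderiv_power poly_add poly_mult poly_power poly_smult uv
    by (simp add: pderiv_pCons algebra_simps)
  have p: "poly [:1, 0, -1:] x = - 4 * u * v"
    "poly [:\<beta> - \<alpha>, - (\<alpha> + \<beta> + 2):] x = - 2 * (\<beta> + 1) * u - 2 * (\<alpha> + 1) * v"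
    by (simp_all add: u_v_def field_simps)
  have "poly [:1, 0, -1:] x * poly (pderiv ([:-1/2, 1/2:] ^ k * [:1/2, 1/2:] ^ m)) x
     = - 2 * v * v ^ m * (real k * u ^ (k - 1) * u) - 2 * u * u ^ k * (real m * v ^ (m - 1) * v)"
    unfolding D p by (simp add: field_simps)
  then show "poly (pearson \<alpha> \<beta> ([:-1/2, 1/2:] ^ k * [:1/2, 1/2:] ^ m)) x =
     poly (smult (- 2 * (real k + \<alpha> + 1)) ([:-1/2, 1/2:] ^ k * [:1/2, 1/2:] ^ Suc m) +
     smult (- 2 * (real m + \<beta> + 1)) ([:-1/2, 1/2:] ^ Suc k * [:1/2, 1/2:] ^ m)) x"
    unfolding pearson_def poly_add poly_mult poly_smult poly_power uv p(2) k m
    by (simp add: algebra_simps)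
qed

lemma pearson_add: "pearson a b (p + q) = pearson a b p + pearson a b q"
  unfolding pearson_def pderiv_add by (simp only: algebra_simps)

lemma pearson_smult: "pearson a b (smult c p) = smult c (pearson a b p)"
  unfolding pearson_def pderiv_smult by (simp only: mult_smult_right smult_add_right)

lemma pearson_sum: "pearson a b (\<Sum>k\<in>A. smult (c k) (f k)) = (\<Sum>k\<in>A. smult (c k) (pearson a b (f k)))"
proof (induction A rule: infinite_finite_induct)
  case (insert k A)
  then show ?case by (simp add: pearson_add pearson_smult)
qed (simp_all add: pearson_def)

lemma smult_sum_right: "smult c (\<Sum>k\<in>A. f k) = (\<Sum>k\<in>A. smult c (f k))"
  by (induction A rule: infinite_finite_induct) (simp_all add: smult_add_right)

lemma jacobi_rodrigues_step:
  "pearson \<alpha> \<beta> (Jacobi (\<alpha> + 1) (\<beta> + 1) n) = smult (- 2 * (real n + 1)) (Jacobi \<alpha> \<beta> (Suc n))"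
proof -
  define c where "c = jacobi_coeff (\<alpha> + 1) (\<beta> + 1) n"
  define d where "d = jacobi_coeff \<alpha> \<beta> (Suc n)"
  define T :: "nat \<Rightarrow> real poly" where "T = (\<lambda>k. [:-1/2, 1/2:] ^ k * [:1/2, 1/2:] ^ (Suc n - k))"
  \<comment> \<open>Binomial absorption: \<open>c1\<close> and \<open>c2\<close> express what the
    \<open>k\<close>-th term contributes to \<open>T k\<close> and to \<open>T (Suc k)\<close> by
    the target coefficients \<open>d\<close>.\<close>
  have c1: "c k * (real k + \<alpha> + 1) = real (Suc n - k) * d k" if "k \<le> n" for k
  proof -
    have "(real k + \<alpha> + 1) * ((real n + (\<alpha> + 1)) gchoose (n - k)) =
        real (Suc n - k) * ((real (Suc n) + \<alpha>) gchoose (Suc n - k))"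
      using gbinomial_Suc_mult[of "real n + 1 + \<alpha>" "n - k"] that
      by (simp add: Suc_diff_le of_nat_diff algebra_simps)
    moreover have "real n + (\<beta> + 1) = real (Suc n) + \<beta>" by simp
    ultimately show ?thesis
      unfolding c_def d_def jacobi_coeff_def by (metis mult.assoc mult.commute)
  qed
  have c2: "c k * (real (n - k) + \<beta> + 1) = real (Suc k) * d (Suc k)" if "k \<le> n" for k
  proof -
    have "(real (n - k) + \<beta> + 1) * ((real n + (\<beta> + 1)) gchoose k) =
        real (Suc k) * ((real (Suc n) + \<beta>) gchoose Suc k)"
      using gbinomial_Suc_mult[of "real n + 1 + \<beta>" k] that
      by (simp add: of_nat_diff algebra_simps)
    moreover have "real n + (\<alpha> + 1) = real (Suc n) + \<alpha>" "n - k = Suc n - Suc k" by simp_all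
    ultimately show ?thesis
      unfolding c_def d_def jacobi_coeff_def by (metis mult.assoc mult.commute)
  qed
  have "pearson \<alpha> \<beta> (Jacobi (\<alpha> + 1) (\<beta> + 1) n) =
      (\<Sum>k\<le>n. smult (c k) (smult (- 2 * (real k + \<alpha> + 1)) (T k) + smult (- 2 * (real (n - k) + \<beta> + 1)) (T (Suc k))))"
    unfolding Jacobi_def pearson_sum pearson_monomial c_def[symmetric] T_def
    by (intro sum.cong refl) (simp add: Suc_diff_le)
  also have "\<dots> = (\<Sum>k\<le>n. smult (- 2) (smult (real (Suc n - k) * d k) (T k) + smult (real (Suc k) * d (Suc k)) (T (Suc k))))"
  proof -
    have "smult (c k) (smult (- 2 * x) p + smult (- 2 * y) q) = smult (- 2) (smult (c k * x) p + smult (c k * y) q)"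
      for k x y p q
      by (simp only: smult_add_right smult_smult mult_ac)
    then show ?thesis by (intro sum.cong refl) (simp only: c1 c2 atMost_iff)
  qed
  also have "\<dots> = smult (- 2) ((\<Sum>k\<le>n. smult (real (Suc n - k) * d k) (T k)) +
      (\<Sum>k\<le>n. smult (real (Suc k) * d (Suc k)) (T (Suc k))))"
    by (simp only: smult_sum_right[symmetric] sum.distrib)
  also have "\<dots> = smult (- 2) ((\<Sum>k\<le>Suc n. smult (real (Suc n - k) * d k) (T k)) +
      (\<Sum>k\<le>Suc n. smult (real k * d k) (T k)))"
  \<comment> \<open>Both sums can run up to \<open>Suc n\<close> over the same index: the new top
    term of the first has factor \<open>Suc n - k = 0\<close>, and the new bottom term of the
    shifted second has factor \<open>k = 0\<close>.\<close>
  proof -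
    have "(\<Sum>k\<le>Suc n. smult (real k * d k) (T k)) = (\<Sum>k\<le>n. smult (real (Suc k) * d (Suc k)) (T (Suc k)))"
      by (subst sum.atMost_Suc_shift) simp
    moreover have "(\<Sum>k\<le>Suc n. smult (real (Suc n - k) * d k) (T k)) = (\<Sum>k\<le>n. smult (real (Suc n - k) * d k) (T k))"
      by simp
    ultimately show ?thesis by (simp only:)
  qed
  also have "\<dots> = smult (- 2) (\<Sum>k\<le>Suc n. smult (real n + 1) (smult (d k) (T k)))"
    unfolding sum.distrib[symmetric]
  proof (intro arg_cong[where f = "smult (- 2)"] sum.cong refl)
    fix k assume "k \<in> {..Suc n}"
    then have "real (Suc n - k) * d k + real k * d k = (real n + 1) * d k"
      by (simp add: of_nat_diff algebra_simps)
    then show "smult (real (Suc n - k) * d k) (T k) + smult (real k * d k) (T k) = smult (real n + 1) (smult (d k) (T k))"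
      by (simp only: smult_add_left[symmetric] smult_smult)
  qed
  also have "\<dots> = smult (- 2 * (real n + 1)) (Jacobi \<alpha> \<beta> (Suc n))"
    by (simp only: Jacobi_def d_def T_def smult_sum_right smult_smult mult.assoc)
  finally show ?thesis .
qed

section \<open>Integration by parts and orthogonality\<close>

lemma jacobi_integral_by_parts:
  assumes "\<alpha> > -1" "\<beta> > -1"
  shows "jacobi_integral \<alpha> \<beta> (Jacobi \<alpha> \<beta> (Suc n) * f) =
    jacobi_integral (\<alpha> + 1) (\<beta> + 1) (Jacobi (\<alpha> + 1) (\<beta> + 1) n * pderiv f) / (2 * real (Suc n))"
  \<comment> \<open>The Leibniz rule splits a vanishing integral in two: the Rodrigues formula
    rewrites the first part, and the factor \<open>1 - x^2\<close> of the second is absorbed into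
    the weight.\<close>
  using jacobi_integral_pearson[OF assms, of "Jacobi (\<alpha> + 1) (\<beta> + 1) n * f"]
  unfolding pearson_mult jacobi_integral_add[OF assms] jacobi_integral_mult_both_endpoints
    jacobi_rodrigues_step mult_smult_left jacobi_integral_smult
  by (simp add: field_simps)

text \<open>Integrating by parts \<open>n\<close> times moves all derivatives to \<open>f\<close>.
  The factor \<open>Suc n\<close> from \<open>coeff_pderiv\<close> cancels the one in the
  denominator at each step, so only powers of 2 remain.\<close>

lemma jacobi_integral_Jacobi_mult:
  assumes "\<alpha> > -1" "\<beta> > -1" "degree f \<le> n"
  shows "jacobi_integral \<alpha> \<beta> (Jacobi \<alpha> \<beta> n * f) = coeff f n / 2 ^ n * jacobi_integral (\<alpha> + n) (\<beta> + n) 1"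
  using assms
proof (induction n arbitrary: \<alpha> \<beta> f)
  case 0
  then obtain c where "f = [:c:]" by (auto elim: degree_eq_zeroE)
  then show ?case using jacobi_integral_smult[of \<alpha> \<beta> c 1] by simp
next
  case (Suc n)
  have "jacobi_integral (\<alpha> + 1) (\<beta> + 1) (Jacobi (\<alpha> + 1) (\<beta> + 1) n * pderiv f) =
      coeff (pderiv f) n / 2 ^ n * jacobi_integral (\<alpha> + 1 + n) (\<beta> + 1 + n) 1"
    using Suc.prems by (intro Suc.IH) (auto simp: degree_pderiv)
  moreover have "\<alpha> + 1 + n = \<alpha> + Suc n" "\<beta> + 1 + n = \<beta> + Suc n" by simp_all
  ultimately show ?case
    by (simp add: jacobi_integral_by_parts[OF Suc.prems(1,2)] coeff_pderiv del: of_nat_Suc)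
qed

text \<open>Here the weight does not match the polynomial, and each step contributes a factor
  \<open>s\<close> instead of a derivative. Raising \<alpha> and \<open>s\<close> together keeps
  \<open>\<alpha> - s\<close> fixed, and the factors \<open>s\<close>, \<open>s + 1\<close>, ...
  build up the Pochhammer symbol. The mirrored case at the other endpoint has the factor
  \<open>- s\<close>, whence the sign \<open>(-1) ^ n\<close>.\<close>

lemma jacobi_integral_Jacobi_diff_left:
  assumes "\<alpha> - s > -1" "\<beta> > -1"
  shows "jacobi_integral (\<alpha> - s) \<beta> (Jacobi \<alpha> \<beta> n) =
    pochhammer s n / (2 ^ n * fact n) * jacobi_integral (\<alpha> - s) (\<beta> + n) 1"
  using assms
proof (induction n arbitrary: \<alpha> \<beta> s)
  case (Suc n)
  have "jacobi_integral (\<alpha> - s) \<beta> (Jacobi \<alpha> \<beta> (Suc n)) =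
      s * jacobi_integral (\<alpha> - s) (\<beta> + 1) (Jacobi (\<alpha> + 1) (\<beta> + 1) n) / (2 * real (Suc n))"
    using jacobi_integral_pearson[OF Suc.prems, of "Jacobi (\<alpha> + 1) (\<beta> + 1) n"]
    unfolding pearson_diff_left jacobi_rodrigues_step jacobi_integral_add[OF Suc.prems]
      jacobi_integral_smult jacobi_integral_mult_left_endpoint by (simp add: field_simps)
  moreover have "jacobi_integral (\<alpha> - s) (\<beta> + 1) (Jacobi (\<alpha> + 1) (\<beta> + 1) n) =
      pochhammer (s + 1) n / (2 ^ n * fact n) * jacobi_integral (\<alpha> - s) (\<beta> + Suc n) 1"
    using Suc.IH[of "\<alpha> + 1" "s + 1" "\<beta> + 1"] Suc.prems by (simp add: add_ac)
  ultimately show ?case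
    by (simp add: pochhammer_rec mult_ac del: of_nat_Suc)
qed simp

lemma jacobi_integral_Jacobi_diff_right:
  assumes "\<alpha> > -1" "\<beta> - s > -1"
  shows "jacobi_integral \<alpha> (\<beta> - s) (Jacobi \<alpha> \<beta> n) =
    (-1) ^ n * pochhammer s n / (2 ^ n * fact n) * jacobi_integral (\<alpha> + n) (\<beta> - s) 1"
  using assms
proof (induction n arbitrary: \<alpha> \<beta> s)
  case (Suc n)
  have "jacobi_integral \<alpha> (\<beta> - s) (Jacobi \<alpha> \<beta> (Suc n)) =
      - s * jacobi_integral (\<alpha> + 1) (\<beta> - s) (Jacobi (\<alpha> + 1) (\<beta> + 1) n) / (2 * real (Suc n))"
    using jacobi_integral_pearson[OF Suc.prems, of "Jacobi (\<alpha> + 1) (\<beta> + 1) n"]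
    unfolding pearson_diff_right jacobi_rodrigues_step jacobi_integral_add[OF Suc.prems]
      jacobi_integral_smult jacobi_integral_mult_right_endpoint by (simp add: field_simps)
  moreover have "jacobi_integral (\<alpha> + 1) (\<beta> - s) (Jacobi (\<alpha> + 1) (\<beta> + 1) n) =
      (-1) ^ n * pochhammer (s + 1) n / (2 ^ n * fact n) * jacobi_integral (\<alpha> + Suc n) (\<beta> - s) 1"
    using Suc.IH[of "\<alpha> + 1" "\<beta> + 1" "s + 1"] Suc.prems by (simp add: add_ac)
  ultimately show ?case
    by (simp add: pochhammer_rec mult_ac del: of_nat_Suc)
qed simp

section \<open>Closed forms in terms of the Gamma function\<close>

lemma jacobi_integral_1:
  assumes "a > -1" "b > -1"
  shows "jacobi_integral a b 1 = 2 powr (a + b + 1) * Gamma (a + 1) * Gamma (b + 1) / Gamma (a + b + 2)"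
  using integral_jacobi_weight[OF assms] by (simp add: jacobi_integral_def Beta_def add_ac)

lemma gbinomial_add_nat_Gamma:
  assumes "c > -1"
  shows "((real n + c) gchoose n) = Gamma (real n + c + 1) / (fact n * Gamma (c + 1))"
  using assms by (subst gbinomial_Gamma) (auto simp: add_ac elim!: nonpos_Ints_cases)

lemma Gamma_plus1_pos: "(c::real) > 0 \<Longrightarrow> Gamma (c + 1) = c * Gamma c"
  by (rule Gamma_plus1) (auto elim!: nonpos_Ints_cases)

lemma jacobi_integral_orthogonal:
  assumes "\<alpha> > -1" "\<beta> > -1" "degree f < n"
  shows "jacobi_integral \<alpha> \<beta> (Jacobi \<alpha> \<beta> n * f) = 0"
  using jacobi_integral_Jacobi_mult[of \<alpha> \<beta> f n] assms by (simp add: coeff_eq_0)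

text \<open>Only the leading coefficient of the second factor matters. Its
  \<open>Gamma (s + 1)\<close> cancels against \<open>Gamma (s + 2)\<close> from the Beta integral
  and leaves \<open>s + 1\<close>; the powers of 2 depending on \<open>n\<close> cancel as
  well.\<close>

lemma jacobi_integral_Jacobi_square:
  assumes "\<alpha> > 0" "\<beta> > 0"
  shows "jacobi_integral \<alpha> \<beta> (Jacobi \<alpha> \<beta> n * Jacobi \<alpha> \<beta> n) =
    2 powr (\<alpha> + \<beta> + 1) * Gamma (real n + \<alpha> + 1) * Gamma (real n + \<beta> + 1) /
    ((2 * real n + \<alpha> + \<beta> + 1) * fact n * Gamma (real n + \<alpha> + \<beta> + 1))"
proof -
  define s where "s = 2 * real n + \<alpha> + \<beta>"
  have s: "s > 0" using assms by (simp add: s_def add_nonneg_pos)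
  have "real n + (real n + (\<alpha> + \<beta>)) = s" by (simp add: s_def)
  then have binom: "(s gchoose n) = Gamma (s + 1) / (fact n * Gamma (real n + \<alpha> + \<beta> + 1))"
    using gbinomial_add_nat_Gamma[of "real n + (\<alpha> + \<beta>)" n] assms by (simp add: add_ac)
  have "s + 1 = (\<alpha> + \<beta> + 1) + (real n + real n)"
    by (simp add: s_def)
  then have "2 powr (s + 1) = 2 powr (\<alpha> + \<beta> + 1) * (2 ^ n * 2 ^ n)"
    by (simp only: powr_add) (simp add: powr_realpow)
  moreover have "Gamma (s + 2) = (s + 1) * Gamma (s + 1)"
    using Gamma_plus1_pos[of "s + 1"] s by (simp add: add_ac)
  moreover have "jacobi_integral (\<alpha> + n) (\<beta> + n) 1 =
      2 powr (s + 1) * Gamma (real n + \<alpha> + 1) * Gamma (real n + \<beta> + 1) / Gamma (s + 2)"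
    using assms by (subst jacobi_integral_1) (simp_all add: s_def add_ac)
  ultimately have norm: "jacobi_integral (\<alpha> + n) (\<beta> + n) 1 = 2 powr (\<alpha> + \<beta> + 1) * (2 ^ n * 2 ^ n) *
      Gamma (real n + \<alpha> + 1) * Gamma (real n + \<beta> + 1) / ((s + 1) * Gamma (s + 1))"
    by simp
  have "jacobi_integral \<alpha> \<beta> (Jacobi \<alpha> \<beta> n * Jacobi \<alpha> \<beta> n) =
      (s gchoose n) / 2 ^ n / 2 ^ n * jacobi_integral (\<alpha> + n) (\<beta> + n) 1"
    using assms
    by (subst jacobi_integral_Jacobi_mult) (auto simp: coeff_Jacobi s_def intro: degree_Jacobi_le)
  also have "\<dots> = 2 powr (\<alpha> + \<beta> + 1) * Gamma (real n + \<alpha> + 1) * Gamma (real n + \<beta> + 1) /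
      ((s + 1) * fact n * Gamma (real n + \<alpha> + \<beta> + 1))"
    using less_imp_neq[OF Gamma_real_pos[of "s + 1"], symmetric] s unfolding binom norm by (simp add: mult_ac)
  finally show ?thesis unfolding s_def .
qed

text \<open>The case \<open>s = 1\<close>, where the Pochhammer symbol is \<open>fact n\<close> and
  cancels.\<close>

lemma jacobi_integral_Jacobi_left:
  assumes "\<alpha> > 0" "\<beta> > 0"
  shows "jacobi_integral (\<alpha> - 1) \<beta> (Jacobi \<alpha> \<beta> n) =
    2 powr (\<alpha> + \<beta>) * Gamma \<alpha> * Gamma (real n + \<beta> + 1) / Gamma (real n + \<alpha> + \<beta> + 1)"
proof -
  have "jacobi_integral (\<alpha> - 1) (\<beta> + n) 1 =
      2 ^ n * (2 powr (\<alpha> + \<beta>) * Gamma \<alpha> * Gamma (real n + \<beta> + 1) / Gamma (real n + \<alpha> + \<beta> + 1))"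
    using assms by (subst jacobi_integral_1) (simp_all add: powr_add powr_realpow add_ac)
  then show ?thesis
    using assms by (subst jacobi_integral_Jacobi_diff_left) (simp_all flip: pochhammer_fact)
qed

lemma jacobi_integral_Jacobi_right:
  assumes "\<alpha> > 0" "\<beta> > 0"
  shows "jacobi_integral \<alpha> (\<beta> - 1) (Jacobi \<alpha> \<beta> n) =
    (-1) ^ n * (2 powr (\<alpha> + \<beta>) * Gamma \<beta> * Gamma (real n + \<alpha> + 1) / Gamma (real n + \<alpha> + \<beta> + 1))"
proof -
  have "jacobi_integral (\<alpha> + n) (\<beta> - 1) 1 =
      2 ^ n * (2 powr (\<alpha> + \<beta>) * Gamma \<beta> * Gamma (real n + \<alpha> + 1) / Gamma (real n + \<alpha> + \<beta> + 1))"
    using assms by (subst jacobi_integral_1) (simp_all add: powr_add powr_realpow add_ac)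
  then show ?thesis
    using assms by (subst jacobi_integral_Jacobi_diff_right) (simp_all flip: pochhammer_fact)
qed

section \<open>Reproduction of endpoint values\<close>

lemma degree_synthetic_div_less:
  assumes "degree f < n"
  shows "degree (synthetic_div f c) < n"
  using assms by (simp add: degree_synthetic_div)

text \<open>Write \<open>f = f(1) + (x - 1) q\<close>. The factor \<open>x - 1\<close> lifts the
  weight exponent from \<open>\<alpha> - 1\<close> to \<alpha>, where \<open>q\<close> is orthogonal
  to \<open>Jacobi \<alpha> \<beta> n\<close> because its degree is below \<open>n\<close>.\<close>

lemma jacobi_integral_reproduce_left:
  assumes "\<alpha> > 0" "\<beta> > 0" "degree f < n"
  shows "jacobi_integral (\<alpha> - 1) \<beta> (Jacobi \<alpha> \<beta> n * f) = poly f 1 * jacobi_integral (\<alpha> - 1) \<beta> (Jacobi \<alpha> \<beta> n)"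
proof -
  define q where "q = synthetic_div f 1"
  have f: "[:-1, 1:] * q + [:poly f 1:] = f"
    unfolding q_def by (rule synthetic_div_correct')
  have "Jacobi \<alpha> \<beta> n * f = smult (-1) ([:1, -1:] * (Jacobi \<alpha> \<beta> n * q)) + smult (poly f 1) (Jacobi \<alpha> \<beta> n)"
    by (subst f[symmetric]) (simp add: algebra_simps)
  moreover have "jacobi_integral \<alpha> \<beta> (Jacobi \<alpha> \<beta> n * q) = 0"
    using assms unfolding q_def by (intro jacobi_integral_orthogonal degree_synthetic_div_less) auto
  ultimately show ?thesis
    using assms by (simp only: jacobi_integral_add jacobi_integral_smult jacobi_integral_mult_right_endpoint) simp
qed

lemma jacobi_integral_reproduce_right:
  assumes "\<alpha> > 0" "\<beta> > 0" "degree f < n"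
  shows "jacobi_integral \<alpha> (\<beta> - 1) (Jacobi \<alpha> \<beta> n * f) = poly f (-1) * jacobi_integral \<alpha> (\<beta> - 1) (Jacobi \<alpha> \<beta> n)"
proof -
  define q where "q = synthetic_div f (-1)"
  have f: "[:1, 1:] * q + [:poly f (-1):] = f"
    using synthetic_div_correct'[of "-1" f] unfolding q_def by simp
  have "Jacobi \<alpha> \<beta> n * f = [:1, 1:] * (Jacobi \<alpha> \<beta> n * q) + smult (poly f (-1)) (Jacobi \<alpha> \<beta> n)"
    by (subst f[symmetric]) (simp add: algebra_simps)
  moreover have "jacobi_integral \<alpha> \<beta> (Jacobi \<alpha> \<beta> n * q) = 0"
    using assms unfolding q_def by (intro jacobi_integral_orthogonal degree_synthetic_div_less) auto
  ultimately show ?thesis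
    using assms by (simp add: jacobi_integral_add jacobi_integral_smult jacobi_integral_mult_left_endpoint
        del: mult_pCons_left)
qed

lemma jacobi_integral_pearson_half:
  assumes "\<alpha> > 0" "\<beta> > 0" "m < n"
  shows "jacobi_integral (\<alpha> - 1) (\<beta> - 1) (pearson (\<alpha> / 2 - 1) (\<beta> / 2 - 1) (Jacobi \<alpha> \<beta> m) * Jacobi \<alpha> \<beta> n) =
    \<beta> / 2 * poly (Jacobi \<alpha> \<beta> m) (-1) * jacobi_integral \<alpha> (\<beta> - 1) (Jacobi \<alpha> \<beta> n)
    - \<alpha> / 2 * poly (Jacobi \<alpha> \<beta> m) 1 * jacobi_integral (\<alpha> - 1) \<beta> (Jacobi \<alpha> \<beta> n)"
proof -
  define p q where "p = Jacobi \<alpha> \<beta> m" "q = Jacobi \<alpha> \<beta> n"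
  have deg: "degree p < n" "degree (pderiv p) < n"
    using degree_Jacobi_le[of \<alpha> \<beta> m] assms(3) by (auto simp: p_q_def degree_pderiv)
  \<comment> \<open>The linear factor in \<open>pearson\<close> equals
    \<open>\<beta> / 2 * (1 - x) - \<alpha> / 2 * (1 + x)\<close>, so each summand carries endpoint
    factors that the weight can absorb.\<close>
  have "pearson (\<alpha> / 2 - 1) (\<beta> / 2 - 1) p * q =
      [:1, 0, -1:] * (q * pderiv p) + (smult (\<beta> / 2) ([:1, -1:] * (q * p)) + smult (- \<alpha> / 2) ([:1, 1:] * (q * p)))"
    by (rule poly_ext) (simp add: pearson_def field_simps)
  then have "jacobi_integral (\<alpha> - 1) (\<beta> - 1) (pearson (\<alpha> / 2 - 1) (\<beta> / 2 - 1) p * q) =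
      jacobi_integral \<alpha> \<beta> (q * pderiv p) + \<beta> / 2 * jacobi_integral \<alpha> (\<beta> - 1) (q * p)
      - \<alpha> / 2 * jacobi_integral (\<alpha> - 1) \<beta> (q * p)"
    using assms by (simp only: jacobi_integral_add jacobi_integral_smult jacobi_integral_mult_left_endpoint
        jacobi_integral_mult_right_endpoint jacobi_integral_mult_both_endpoints) simp
  then show ?thesis
    using assms deg unfolding p_q_def
    by (simp add: jacobi_integral_orthogonal jacobi_integral_reproduce_left jacobi_integral_reproduce_right)
qed

section \<open>The differentiation matrix\<close>

lemma jacobi_weight_mult:
  "jacobi_weight a b x * jacobi_weight c d x = jacobi_weight (a + c) (b + d) x"
  by (simp add: jacobi_weight_def powr_add)

lemma jacobi_W_eq: "jacobi_W \<alpha> \<beta> n x = jacobi_kappa \<alpha> \<beta> n * (jacobi_weight (\<alpha> / 2) (\<beta> / 2) x * poly (Jacobi \<alpha> \<beta> n) x)"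
  by (simp add: jacobi_W_def jacobi_orthonormal_def jacobi_weight_def poly_Jacobi)

text \<open>A W-function is a polynomial times the weight with halved exponents;
  \<open>pearson\<close> differentiates a weight with exponents \<open>a + 1\<close> and
  \<open>b + 1\<close>, hence the shift by 1.\<close>

lemma deriv_jacobi_W:
  assumes "x \<in> {-1<..<1}"
  shows "deriv (jacobi_W \<alpha> \<beta> n) x = jacobi_kappa \<alpha> \<beta> n *
    (jacobi_weight (\<alpha> / 2 - 1) (\<beta> / 2 - 1) x * poly (pearson (\<alpha> / 2 - 1) (\<beta> / 2 - 1) (Jacobi \<alpha> \<beta> n)) x)"
proof (rule DERIV_imp_deriv)
  show "(jacobi_W \<alpha> \<beta> n has_real_derivative jacobi_kappa \<alpha> \<beta> n *
    (jacobi_weight (\<alpha> / 2 - 1) (\<beta> / 2 - 1) x * poly (pearson (\<alpha> / 2 - 1) (\<beta> / 2 - 1) (Jacobi \<alpha> \<beta> n)) x)) (at x)"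
    unfolding jacobi_W_eq[abs_def]
    using jacobi_weight_poly_has_derivative[OF assms, of "\<alpha> / 2 - 1" "\<beta> / 2 - 1" "Jacobi \<alpha> \<beta> n"]
    by (intro DERIV_cmult) simp
qed

lemma deriv_jacobi_W_mult:
  assumes "x \<in> {-1<..<1}"
  shows "deriv (jacobi_W \<alpha> \<beta> m) x * jacobi_W \<alpha> \<beta> n x = jacobi_kappa \<alpha> \<beta> m * jacobi_kappa \<alpha> \<beta> n *
    (jacobi_weight (\<alpha> - 1) (\<beta> - 1) x *
     poly (pearson (\<alpha> / 2 - 1) (\<beta> / 2 - 1) (Jacobi \<alpha> \<beta> m) * Jacobi \<alpha> \<beta> n) x)"
proof -
  have "jacobi_weight (\<alpha> - 1) (\<beta> - 1) x = jacobi_weight (\<alpha> / 2 - 1) (\<beta> / 2 - 1) x * jacobi_weight (\<alpha> / 2) (\<beta> / 2) x"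
    unfolding jacobi_weight_mult by (simp add: algebra_simps)
  then show ?thesis
    unfolding deriv_jacobi_W[OF assms] jacobi_W_eq by simp
qed

lemma set_integrable_deriv_jacobi_W:
  assumes "\<alpha> > 0" "\<beta> > 0"
  shows "set_integrable lborel {-1<..<1} (\<lambda>x. deriv (jacobi_W \<alpha> \<beta> m) x * jacobi_W \<alpha> \<beta> n x)"
proof -
  have "set_integrable lborel {-1<..<1} (\<lambda>x. jacobi_kappa \<alpha> \<beta> m * jacobi_kappa \<alpha> \<beta> n *
    (jacobi_weight (\<alpha> - 1) (\<beta> - 1) x *
     poly (pearson (\<alpha> / 2 - 1) (\<beta> / 2 - 1) (Jacobi \<alpha> \<beta> m) * Jacobi \<alpha> \<beta> n) x))"
    using assms by (intro set_integrable_mult_right set_integrable_jacobi_weight_poly) auto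
  then show ?thesis
    by (subst set_integrable_cong[OF refl refl deriv_jacobi_W_mult])
qed

lemma jacobi_diff_matrix_eq:
  "jacobi_diff_matrix \<alpha> \<beta> m n = jacobi_kappa \<alpha> \<beta> m * jacobi_kappa \<alpha> \<beta> n *
     jacobi_integral (\<alpha> - 1) (\<beta> - 1) (pearson (\<alpha> / 2 - 1) (\<beta> / 2 - 1) (Jacobi \<alpha> \<beta> m) * Jacobi \<alpha> \<beta> n)"
  unfolding jacobi_diff_matrix_def jacobi_integral_def set_integral_mult_right[symmetric]
  by (intro set_lebesgue_integral_cong) (auto simp: deriv_jacobi_W_mult)

text \<open>By \<open>pearson_add_mult\<close> an entry and its mirror image add up to the integral
  of a total derivative, with parameters \<open>\<alpha> - 1\<close> and \<open>\<beta> - 1\<close>,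
  both above -1.\<close>

lemma jacobi_diff_matrix_antisym:
  assumes "\<alpha> > 0" "\<beta> > 0"
  shows "jacobi_diff_matrix \<alpha> \<beta> m n = - jacobi_diff_matrix \<alpha> \<beta> n m"
proof -
  have "jacobi_integral (\<alpha> - 1) (\<beta> - 1) (pearson (\<alpha> / 2 - 1) (\<beta> / 2 - 1) (Jacobi \<alpha> \<beta> m) * Jacobi \<alpha> \<beta> n)
      + jacobi_integral (\<alpha> - 1) (\<beta> - 1) (pearson (\<alpha> / 2 - 1) (\<beta> / 2 - 1) (Jacobi \<alpha> \<beta> n) * Jacobi \<alpha> \<beta> m)
      = jacobi_integral (\<alpha> - 1) (\<beta> - 1) (pearson (\<alpha> - 1) (\<beta> - 1) (Jacobi \<alpha> \<beta> m * Jacobi \<alpha> \<beta> n))"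
    using pearson_add_mult[of "\<alpha> / 2 - 1" "\<beta> / 2 - 1" "Jacobi \<alpha> \<beta> m" "Jacobi \<alpha> \<beta> n" "\<alpha> / 2 - 1" "\<beta> / 2 - 1"] assms
    by (simp add: mult.commute[of "Jacobi \<alpha> \<beta> m"] flip: jacobi_integral_add)
  also have "\<dots> = 0" using assms by (intro jacobi_integral_pearson) auto
  finally have "jacobi_integral (\<alpha> - 1) (\<beta> - 1) (pearson (\<alpha> / 2 - 1) (\<beta> / 2 - 1) (Jacobi \<alpha> \<beta> m) * Jacobi \<alpha> \<beta> n)
      = - jacobi_integral (\<alpha> - 1) (\<beta> - 1) (pearson (\<alpha> / 2 - 1) (\<beta> / 2 - 1) (Jacobi \<alpha> \<beta> n) * Jacobi \<alpha> \<beta> m)"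
    by linarith
  then show ?thesis unfolding jacobi_diff_matrix_eq by simp
qed

section \<open>Normalization constants and generators\<close>

lemma jacobi_kappa_eq:
  assumes "\<alpha> > 0" "\<beta> > 0"
  shows "jacobi_kappa \<alpha> \<beta> n = sqrt ((2 * real n + \<alpha> + \<beta> + 1) * fact n * Gamma (real n + \<alpha> + \<beta> + 1) /
    (2 powr (\<alpha> + \<beta> + 1) * Gamma (real n + \<alpha> + 1) * Gamma (real n + \<beta> + 1)))"
proof -
  have "jacobi_kappa \<alpha> \<beta> n = 1 / sqrt (jacobi_integral \<alpha> \<beta> (Jacobi \<alpha> \<beta> n * Jacobi \<alpha> \<beta> n))"
    by (simp add: jacobi_kappa_def jacobi_integral_def poly_Jacobi mult.assoc)
  then show ?thesis
    unfolding jacobi_integral_Jacobi_square[OF assms]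
    by (simp flip: real_sqrt_inverse add: divide_simps real_sqrt_divide)
qed

text \<open>Exhibits \<open>jacobi_kappa\<close> in every generator, up to a ratio of Gamma values
  or factorials; \<open>E\<close> removes the power of 2 contained in
  \<open>jacobi_kappa\<close>.\<close>

lemma
  assumes "\<alpha> > 0" "\<beta> > 0"
  defines "E \<equiv> sqrt (2 powr (\<alpha> + \<beta> + 1))"
  shows gen_a1_eq: "gen_a1 \<alpha> \<beta> n = (-1) ^ n / 2 * (E * jacobi_kappa \<alpha> \<beta> n * (Gamma (real n + \<beta> + 1) / fact n))"
    and gen_a2_eq: "gen_a2 \<alpha> \<beta> n = - 1 / 2 * (E * jacobi_kappa \<alpha> \<beta> n * (Gamma (real n + \<alpha> + 1) / fact n))"
    and gen_b1_eq: "gen_b1 \<alpha> \<beta> n = (-1) ^ n / 2 *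
      (E * jacobi_kappa \<alpha> \<beta> n * (Gamma (real n + \<alpha> + 1) / Gamma (real n + \<alpha> + \<beta> + 1)))"
    and gen_b2_eq: "gen_b2 \<alpha> \<beta> n = 1 / 2 *
      (E * jacobi_kappa \<alpha> \<beta> n * (Gamma (real n + \<beta> + 1) / Gamma (real n + \<alpha> + \<beta> + 1)))"
proof -
  have pos: "Gamma (real n + \<alpha> + 1) > 0" "Gamma (real n + \<beta> + 1) > 0" "Gamma (real n + \<alpha> + \<beta> + 1) > 0"
    using assms by (auto intro!: Gamma_real_pos add_nonneg_pos)
  \<comment> \<open>A positive \<open>y\<close> moves under the root as its square; for the four
    ratios the radicand then cancels to that of the generator.\<close>
  have E: "E * jacobi_kappa \<alpha> \<beta> n * y = sqrt ((2 * real n + \<alpha> + \<beta> + 1) * fact n * Gamma (real n + \<alpha> + \<beta> + 1) /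
    (Gamma (real n + \<alpha> + 1) * Gamma (real n + \<beta> + 1)) * y ^ 2)" if "y > 0" for y
  proof -
    have "E * jacobi_kappa \<alpha> \<beta> n * y = E * jacobi_kappa \<alpha> \<beta> n * sqrt (y ^ 2)"
      using that by simp
    then show ?thesis
      unfolding E_def jacobi_kappa_eq[OF assms(1,2)] real_sqrt_mult[symmetric] by simp
  qed
  show "gen_a1 \<alpha> \<beta> n = (-1) ^ n / 2 * (E * jacobi_kappa \<alpha> \<beta> n * (Gamma (real n + \<beta> + 1) / fact n))"
    unfolding gen_a1_def using pos by (subst E) (simp_all add: power2_eq_square mult_ac)
  show "gen_a2 \<alpha> \<beta> n = - 1 / 2 * (E * jacobi_kappa \<alpha> \<beta> n * (Gamma (real n + \<alpha> + 1) / fact n))"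
    unfolding gen_a2_def using pos by (subst E) (simp_all add: power2_eq_square mult_ac)
  show "gen_b1 \<alpha> \<beta> n = (-1) ^ n / 2 *
      (E * jacobi_kappa \<alpha> \<beta> n * (Gamma (real n + \<alpha> + 1) / Gamma (real n + \<alpha> + \<beta> + 1)))"
    unfolding gen_b1_def using pos by (subst E) (simp_all add: power2_eq_square mult_ac)
  show "gen_b2 \<alpha> \<beta> n = 1 / 2 *
      (E * jacobi_kappa \<alpha> \<beta> n * (Gamma (real n + \<beta> + 1) / Gamma (real n + \<alpha> + \<beta> + 1)))"
    unfolding gen_b2_def using pos by (subst E) (simp_all add: power2_eq_square mult_ac)
qed

lemma jacobi_diff_matrix_above_diagonal:
  assumes "\<alpha> > 0" "\<beta> > 0" "m < n"
  shows "jacobi_diff_matrix \<alpha> \<beta> m n = gen_a1 \<alpha> \<beta> m * gen_b1 \<alpha> \<beta> n + gen_a2 \<alpha> \<beta> m * gen_b2 \<alpha> \<beta> n"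
proof -
  \<comment> \<open>Merges the binomial endpoint value with the factor \<alpha> or \<beta> and the
    \<open>Gamma\<close> value of the integral over
    \<open>Jacobi \<alpha> \<beta> n\<close>.\<close>
  have c: "c * (((real m + c) gchoose m) * Gamma c) = Gamma (real m + c + 1) / fact m" if "c > 0" for c :: real
    using that less_imp_neq[OF Gamma_real_pos[OF that], symmetric]
    by (simp add: gbinomial_add_nat_Gamma Gamma_plus1_pos)
  define E where "E = 2 powr (\<alpha> + \<beta>)"
  have EE: "sqrt (2 powr (\<alpha> + \<beta> + 1)) * sqrt (2 powr (\<alpha> + \<beta> + 1)) = 2 * E"
    by (simp add: E_def powr_add)
  define K where "K = jacobi_kappa \<alpha> \<beta> m * jacobi_kappa \<alpha> \<beta> n"
  define G where "G = Gamma (real n + \<alpha> + \<beta> + 1)"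
  have "jacobi_diff_matrix \<alpha> \<beta> m n =
     K * (E * (-1) ^ m * (-1) ^ n * (\<beta> * (((real m + \<beta>) gchoose m) * Gamma \<beta>)) * Gamma (real n + \<alpha> + 1) / (2 * G)
        - E * (\<alpha> * (((real m + \<alpha>) gchoose m) * Gamma \<alpha>)) * Gamma (real n + \<beta> + 1) / (2 * G))"
    unfolding jacobi_diff_matrix_eq jacobi_integral_pearson_half[OF assms] Jacobi_at_1 Jacobi_at_minus_1
      jacobi_integral_Jacobi_left[OF assms(1,2)] jacobi_integral_Jacobi_right[OF assms(1,2)]
      K_def[symmetric] G_def[symmetric] E_def[symmetric]
    by (simp add: mult_ac)
  also have "\<dots> = gen_a1 \<alpha> \<beta> m * gen_b1 \<alpha> \<beta> n + gen_a2 \<alpha> \<beta> m * gen_b2 \<alpha> \<beta> n"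
  proof -
    \<comment> \<open>Brings the two square roots together so that \<open>EE\<close> applies;
      \<open>2 * E\<close> over 4 is the \<open>E / 2\<close> of the left-hand side.\<close>
    have *: "(x / 2 * (S * k * y)) * (x' / 2 * (S * k' * y')) = (S * S) * (x * x' * (k * k') * (y * y')) / 4"
      for x S k y x' k' y' :: real by simp
    show ?thesis
      unfolding c[OF assms(1)] c[OF assms(2)] gen_a1_eq[OF assms(1,2)] gen_a2_eq[OF assms(1,2)]
        gen_b1_eq[OF assms(1,2)] gen_b2_eq[OF assms(1,2)] * EE K_def[symmetric] G_def[symmetric]
      by (simp add: algebra_simps)
  qed
  finally show ?thesis .
qed

section \<open>Rank of submatrices and the final result\<close>

lemma submatrix_rank_le_2:
  assumes "\<And>i j. i \<in> I \<Longrightarrow> j \<in> J \<Longrightarrow> A i j = a i * u j + b i * v j"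
  shows "submatrix_rank A I J \<le> 2"
proof -
  interpret V: vector_space seq_scale by (rule vector_space_seq_scale)
  \<comment> \<open>The generators get the same extension by zero outside \<open>J\<close> as the
    rows, so every row is a combination of \<open>r u\<close> and \<open>r v\<close>.\<close>
  define r where "r = (\<lambda>w j. if j \<in> J then w j else (0 :: real))"
  have "(\<lambda>i j. if j \<in> J then A i j else 0) ` I \<subseteq> V.span {r u, r v}"
  proof safe
    fix i assume "i \<in> I"
    then have "(\<lambda>j. if j \<in> J then A i j else 0) = seq_scale (a i) (r u) + seq_scale (b i) (r v)"
      using assms by (auto simp: fun_eq_iff seq_scale_def r_def)
    moreover have "seq_scale (a i) (r u) + seq_scale (b i) (r v) \<in> V.span {r u, r v}"
      by (intro V.span_add V.span_scale V.span_base) auto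
    ultimately show "(\<lambda>j. if j \<in> J then A i j else 0) \<in> V.span {r u, r v}"
      by simp
  qed
  then have "submatrix_rank A I J \<le> card {r u, r v}"
    unfolding submatrix_rank_def by (rule V.dim_le_card) simp
  also have "\<dots> \<le> 2" by (simp add: card_insert_if)
  finally show ?thesis .
qed

theorem theorem3p1:
  fixes \<alpha> \<beta> :: real
  assumes "\<alpha> > 0" and "\<beta> > 0"
  shows "(\<forall>m n. set_integrable lborel {-1<..<1}
                   (\<lambda>x. deriv (jacobi_W \<alpha> \<beta> m) x * jacobi_W \<alpha> \<beta> n x))
       \<and> semi_separable 2 (jacobi_diff_matrix \<alpha> \<beta>)
       \<and> (\<forall>m n. jacobi_diff_matrix \<alpha> \<beta> m n =
            (if m + 1 \<le> n then gen_a1 \<alpha> \<beta> m * gen_b1 \<alpha> \<beta> n + gen_a2 \<alpha> \<beta> m * gen_b2 \<alpha> \<beta> n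
             else if m = n then 0
             else - (gen_b1 \<alpha> \<beta> m * gen_a1 \<alpha> \<beta> n + gen_b2 \<alpha> \<beta> m * gen_a2 \<alpha> \<beta> n)))"
proof (intro conjI allI)
  note above = jacobi_diff_matrix_above_diagonal[OF assms]
  \<comment> \<open>The signs sit on the row factors so that the entry has the two-term shape
    required by \<open>submatrix_rank_le_2\<close>.\<close>
  have below: "jacobi_diff_matrix \<alpha> \<beta> m n = - gen_b1 \<alpha> \<beta> m * gen_a1 \<alpha> \<beta> n + - gen_b2 \<alpha> \<beta> m * gen_a2 \<alpha> \<beta> n"
    if "n < m" for m n
    using jacobi_diff_matrix_antisym[OF assms, of m n] above[OF that] by simp
  have diagonal: "jacobi_diff_matrix \<alpha> \<beta> m m = 0" for m
    using jacobi_diff_matrix_antisym[OF assms, of m m] by simp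
  show "set_integrable lborel {-1<..<1} (\<lambda>x. deriv (jacobi_W \<alpha> \<beta> m) x * jacobi_W \<alpha> \<beta> n x)" for m n
    by (rule set_integrable_deriv_jacobi_W[OF assms])
  show "jacobi_diff_matrix \<alpha> \<beta> m n =
      (if m + 1 \<le> n then gen_a1 \<alpha> \<beta> m * gen_b1 \<alpha> \<beta> n + gen_a2 \<alpha> \<beta> m * gen_b2 \<alpha> \<beta> n
       else if m = n then 0
       else - (gen_b1 \<alpha> \<beta> m * gen_a1 \<alpha> \<beta> n + gen_b2 \<alpha> \<beta> m * gen_a2 \<alpha> \<beta> n))" for m n
    using above[of m n] below[of n m] diagonal[of m] by (cases m n rule: linorder_cases) auto
  have "submatrix_rank (jacobi_diff_matrix \<alpha> \<beta>) I J \<le> 2" if "\<forall>i\<in>I. \<forall>j\<in>J. i < j" for I J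
    by (rule submatrix_rank_le_2[OF above]) (use that in auto)
  moreover have "submatrix_rank (jacobi_diff_matrix \<alpha> \<beta>) I J \<le> 2" if "\<forall>i\<in>I. \<forall>j\<in>J. j < i" for I J
    by (rule submatrix_rank_le_2[OF below]) (use that in auto)
  ultimately show "semi_separable 2 (jacobi_diff_matrix \<alpha> \<beta>)"
    unfolding semi_separable_def by auto
qed

end
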